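(* Let $(X,r)$ be a left non-degenerate solution and let $\kappa:X\to X$ be a $\lambda$-centralizing map for $(X,r)$. Then $\kappa$ is a reflection for $(X,r)$ if and only if $\kappa$ is a reflection for the left derived solution $(X,r_\triangleright)$ of $(X,r)$.
   Context: A (set-theoretic) solution (of the Yang-Baxter equation) is a pair $(X,r)$ with $X$ a set and $r:X\times X\to X\times X$ a map satisfying $(r\times \mathrm{id}_X)(\mathrm{id}_X\times r)(r\times \mathrm{id}_X)=(\mathrm{id}_X\times r)(r\times \mathrm{id}_X)(\mathrm{id}_X\times r)$. Write $r(x,y)=(\lambda_x(y),\rho_y(x))$. The solution is left non-degenerate if every $\lambda_x:X\to X$ is bijective. A reflection for $(X,r)$ is a map $\kappa:X\to X$ with $r(\mathrm{id}_X\times\kappa)r(\mathrm{id}_X\times\kappa)=(\mathrm{id}_X\times\kappa)r(\mathrm{id}_X\times\kappa)r$. A map $\kappa:X\to X$ is $\lambda$-centralizing for $(X,r)$ if $\lambda_x\kappa=\kappa\lambda_x$ for all $x\in X$. If $(X,r)$ is left non-degenerate, its associated left shelf is $(X,\triangleright_r)$ with $x\triangleright_r y:=\lambda_x\rho_{\lambda_y^{-1}(x)}(y)$ (a left self-distributive operation). The left derived solution of $(X,r)$ is the solution $(X,r_\triangleright)$ given by $r_\triangleright(x,y)=(y,\,y\triangleright_r x)$ for all $x,y\in X$. *)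

theory Defs
  imports "HOL-Library.FuncSet"
begin

text \<open>
  Sets are carriers \<open>X :: 'a set\<close>, maps on them are total HOL functions whose values outside
  the carrier are irrelevant: all identities below are required on carrier elements only.
  \<open>X \<times> X \<times> X\<close> is nested to the right, so \<open>id \<times> r\<close> is \<open>map_prod id r\<close>
  while \<open>r \<times> id\<close> has to reassociate.
\<close>

definition times_id :: "('a \<times> 'a \<Rightarrow> 'a \<times> 'a) \<Rightarrow> 'a \<times> 'a \<times> 'a \<Rightarrow> 'a \<times> 'a \<times> 'a" where
  "times_id r = (\<lambda>(x, y, z). (fst (r (x, y)), snd (r (x, y)), z))"

definition id_times :: "('b \<Rightarrow> 'c) \<Rightarrow> 'a \<times> 'b \<Rightarrow> 'a \<times> 'c" where
  "id_times f = map_prod id f"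

definition yb_solution :: "'a set \<Rightarrow> ('a \<times> 'a \<Rightarrow> 'a \<times> 'a) \<Rightarrow> bool" where
  "yb_solution X r \<longleftrightarrow>
     r \<in> X \<times> X \<rightarrow> X \<times> X \<and>
     (\<forall>t \<in> X \<times> X \<times> X.
        (times_id r \<circ> id_times r \<circ> times_id r) t = (id_times r \<circ> times_id r \<circ> id_times r) t)"

text \<open>\<open>r (x, y) = (lam r x y, rho r y x)\<close>; note the order of the arguments of \<open>rho\<close>.\<close>

definition lam :: "('a \<times> 'a \<Rightarrow> 'a \<times> 'a) \<Rightarrow> 'a \<Rightarrow> 'a \<Rightarrow> 'a" where
  "lam r x y = fst (r (x, y))"

definition rho :: "('a \<times> 'a \<Rightarrow> 'a \<times> 'a) \<Rightarrow> 'a \<Rightarrow> 'a \<Rightarrow> 'a" where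
  "rho r y x = snd (r (x, y))"

definition left_nondegenerate :: "'a set \<Rightarrow> ('a \<times> 'a \<Rightarrow> 'a \<times> 'a) \<Rightarrow> bool" where
  "left_nondegenerate X r \<longleftrightarrow> (\<forall>x \<in> X. bij_betw (lam r x) X X)"

definition reflection :: "'a set \<Rightarrow> ('a \<times> 'a \<Rightarrow> 'a \<times> 'a) \<Rightarrow> ('a \<Rightarrow> 'a) \<Rightarrow> bool" where
  "reflection X r \<kappa> \<longleftrightarrow>
     \<kappa> \<in> X \<rightarrow> X \<and>
     (\<forall>p \<in> X \<times> X.
        (r \<circ> id_times \<kappa> \<circ> r \<circ> id_times \<kappa>) p = (id_times \<kappa> \<circ> r \<circ> id_times \<kappa> \<circ> r) p)"

definition lam_centralizing :: "'a set \<Rightarrow> ('a \<times> 'a \<Rightarrow> 'a \<times> 'a) \<Rightarrow> ('a \<Rightarrow> 'a) \<Rightarrow> bool" where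
  "lam_centralizing X r \<kappa> \<longleftrightarrow>
     \<kappa> \<in> X \<rightarrow> X \<and>
     (\<forall>x \<in> X. \<forall>y \<in> X. (lam r x \<circ> \<kappa>) y = (\<kappa> \<circ> lam r x) y)"

definition left_shelf_op :: "'a set \<Rightarrow> ('a \<times> 'a \<Rightarrow> 'a \<times> 'a) \<Rightarrow> 'a \<Rightarrow> 'a \<Rightarrow> 'a" where
  "left_shelf_op X r x y = lam r x (rho r (inv_into X (lam r y) x) y)"

definition left_derived :: "'a set \<Rightarrow> ('a \<times> 'a \<Rightarrow> 'a \<times> 'a) \<Rightarrow> 'a \<times> 'a \<Rightarrow> 'a \<times> 'a" where
  "left_derived X r = (\<lambda>(x, y). (y, left_shelf_op X r y x))"

end

theory Submission
  imports Defs
begin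

text \<open>
  Both reflection equations reduce to the same two identities in the left shelf.
  Put \<open>u = \<lambda>\<^sub>x(y)\<close>; as \<open>\<lambda>\<^sub>x\<close> is bijective, the pairs \<open>(x, u)\<close> range over all
  of \<open>X \<times> X\<close> just as the pairs \<open>(x, y)\<close> do. The definition of \<open>\<triangleright>\<close> says precisely that
  \<open>\<lambda>\<close> of the first output of \<open>r\<close> carries the second output to a shelf product:
  \<open>\<lambda>\<^sub>u(\<rho>\<^sub>y(x)) = u \<triangleright> x\<close> (lemma \<open>lam_rho\<close>). Moving \<open>\<kappa>\<close> through the maps
  \<open>\<lambda>\<close>, the first components of the reflection equation of \<open>r\<close> at \<open>(x, y)\<close> become
  \<open>\<kappa>(\<kappa>(u) \<triangleright> x) = \<kappa>(u \<triangleright> x)\<close>. Let \<open>a\<close> be this common value. Applying \<open>\<lambda>\<^sub>a\<close>, which is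
  injective, to the second components turns their equality into \<open>a \<triangleright> \<kappa>(u) = \<kappa>(a \<triangleright> u)\<close>
  (lemma \<open>reflection_iff_shelf\<close>). For the derived solution the same two identities appear by
  mere evaluation, with \<open>y\<close> in place of \<open>u\<close> (lemma \<open>reflection_shelf_solution_iff\<close>).
\<close>

definition shelf_reflection :: "'a set \<Rightarrow> ('a \<Rightarrow> 'a \<Rightarrow> 'a) \<Rightarrow> ('a \<Rightarrow> 'a) \<Rightarrow> bool" where
  "shelf_reflection X t \<kappa> \<longleftrightarrow> \<kappa> \<in> X \<rightarrow> X \<and>
     (\<forall>x \<in> X. \<forall>u \<in> X. \<kappa> (t (\<kappa> u) x) = \<kappa> (t u x) \<and>
        t (\<kappa> (t u x)) (\<kappa> u) = \<kappa> (t (\<kappa> (t u x)) u))"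

lemma reflection_shelf_solution_iff:
  "reflection X (\<lambda>(x, y). (y, t y x)) \<kappa> \<longleftrightarrow> shelf_reflection X t \<kappa>"
  unfolding reflection_def shelf_reflection_def id_times_def
  by (auto simp: Ball_def cong: conj_cong)

lemma reflection_iff_lam_rho:
  "reflection X r \<kappa> \<longleftrightarrow> \<kappa> \<in> X \<rightarrow> X \<and>
     (\<forall>x \<in> X. \<forall>y \<in> X.
        lam r (lam r x (\<kappa> y)) (\<kappa> (rho r (\<kappa> y) x)) = lam r (lam r x y) (\<kappa> (rho r y x)) \<and>
        rho r (\<kappa> (rho r (\<kappa> y) x)) (lam r x (\<kappa> y)) = \<kappa> (rho r (\<kappa> (rho r y x)) (lam r x y)))"
proof -
  have map_prod_eq: "map_prod id \<kappa> p = (fst p, \<kappa> (snd p))" for p :: "'a \<times> 'a"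
    by (cases p) simp
  show ?thesis
    unfolding reflection_def id_times_def lam_def rho_def by (simp add: prod_eq_iff map_prod_eq)
qed

context
  fixes X :: "'a set" and r :: "'a \<times> 'a \<Rightarrow> 'a \<times> 'a"
  assumes r_closed: "r \<in> X \<times> X \<rightarrow> X \<times> X"
    and nondeg: "left_nondegenerate X r"
begin

lemma lam_closed: "x \<in> X \<Longrightarrow> y \<in> X \<Longrightarrow> lam r x y \<in> X"
  using r_closed unfolding lam_def by (fastforce simp: Pi_iff mem_Times_iff)

lemma rho_closed: "x \<in> X \<Longrightarrow> y \<in> X \<Longrightarrow> rho r y x \<in> X"
  using r_closed unfolding rho_def by (fastforce simp: Pi_iff mem_Times_iff)

lemma lam_eq_iff: "x \<in> X \<Longrightarrow> y \<in> X \<Longrightarrow> z \<in> X \<Longrightarrow> lam r x y = lam r x z \<longleftrightarrow> y = z"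
  using nondeg unfolding left_nondegenerate_def by (meson bij_betw_imp_inj_on inj_on_eq_iff)

lemma ball_lam: "x \<in> X \<Longrightarrow> (\<forall>u \<in> X. P u) \<longleftrightarrow> (\<forall>y \<in> X. P (lam r x y))"
  using nondeg unfolding left_nondegenerate_def by (metis bij_betw_imp_surj_on ball_simps(9))

text \<open>
  The inverse in the definition of \<open>u \<triangleright> x\<close> recovers the \<open>y\<close> with \<open>u = \<lambda>\<^sub>x(y)\<close>, so
  \<open>\<triangleright>\<close> can be used below in an inverse-free form.
\<close>
lemma lam_rho:
  assumes "x \<in> X" "y \<in> X"
  shows "lam r (lam r x y) (rho r y x) = left_shelf_op X r (lam r x y) x"
proof -
  have "inj_on (lam r x) X"
    using nondeg assms(1) unfolding left_nondegenerate_def by (meson bij_betw_imp_inj_on)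
  then show ?thesis
    using assms(2) by (simp add: left_shelf_op_def)
qed

text \<open>
  The reflection equation of \<open>r\<close> depends on \<open>r\<close> only through its left shelf, once \<open>\<kappa>\<close>
  commutes with the maps \<open>\<lambda>\<close>: applying these maps converts every \<open>\<rho>\<close> into a shelf product,
  and no information is lost because they are injective.
\<close>
lemma reflection_iff_shelf:
  assumes cent: "lam_centralizing X r \<kappa>"
  shows "reflection X r \<kappa> \<longleftrightarrow> shelf_reflection X (left_shelf_op X r) \<kappa>"
proof -
  let ?t = "left_shelf_op X r"
  have k_closed: "\<kappa> y \<in> X" if "y \<in> X" for y
    using cent that unfolding lam_centralizing_def by auto
  have lam_k: "lam r x (\<kappa> y) = \<kappa> (lam r x y)" if "x \<in> X" "y \<in> X" for x y
    using cent that unfolding lam_centralizing_def by simp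
  have pointwise:
    "lam r (lam r x (\<kappa> y)) (\<kappa> (rho r (\<kappa> y) x)) = lam r (lam r x y) (\<kappa> (rho r y x)) \<and>
     rho r (\<kappa> (rho r (\<kappa> y) x)) (lam r x (\<kappa> y)) = \<kappa> (rho r (\<kappa> (rho r y x)) (lam r x y))
     \<longleftrightarrow> \<kappa> (?t (\<kappa> (lam r x y)) x) = \<kappa> (?t (lam r x y) x) \<and>
        ?t (\<kappa> (?t (lam r x y) x)) (\<kappa> (lam r x y)) = \<kappa> (?t (\<kappa> (?t (lam r x y) x)) (lam r x y))"
    (is "?first \<and> ?second \<longleftrightarrow> ?shelf1 \<and> ?shelf2")
    if x: "x \<in> X" and y: "y \<in> X" for x y
  proof -
    define u where "u = lam r x y"
    define v where "v = rho r y x"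
    define w where "w = rho r (\<kappa> y) x"
    define a where "a = \<kappa> (?t u x)"
    have closed: "u \<in> X" "v \<in> X" "w \<in> X" "\<kappa> u \<in> X" "\<kappa> v \<in> X" "\<kappa> w \<in> X"
      by (simp_all add: u_def v_def w_def x y k_closed lam_closed rho_closed)
    have ku: "lam r x (\<kappa> y) = \<kappa> u"
      by (simp add: u_def lam_k x y)
    have u_kv: "lam r u (\<kappa> v) = a"
      using lam_rho[OF x y] by (simp add: a_def lam_k closed flip: u_def v_def)
    have ku_kw: "lam r (\<kappa> u) (\<kappa> w) = \<kappa> (?t (\<kappa> u) x)"
      using lam_rho[OF x k_closed[OF y]] by (simp add: lam_k closed ku flip: w_def)
    have first: "?first \<longleftrightarrow> \<kappa> (?t (\<kappa> u) x) = a"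
      unfolding u_def[symmetric] v_def[symmetric] w_def[symmetric] ku u_kv ku_kw ..
    have "rho r (\<kappa> w) (\<kappa> u) = \<kappa> (rho r (\<kappa> v) u) \<longleftrightarrow> ?t a (\<kappa> u) = \<kappa> (?t a u)"
      if eq: "\<kappa> (?t (\<kappa> u) x) = a"
    proof -
      have a: "a \<in> X"
        using lam_closed[of u "\<kappa> v"] closed u_kv by simp
      have "lam r a (rho r (\<kappa> w) (\<kappa> u)) = ?t a (\<kappa> u)"
        using lam_rho[of "\<kappa> u" "\<kappa> w"] closed ku_kw eq by simp
      moreover have "lam r a (\<kappa> (rho r (\<kappa> v) u)) = \<kappa> (?t a u)"
        using lam_rho[of u "\<kappa> v"] closed u_kv a by (simp add: lam_k rho_closed)
      ultimately show ?thesis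
        using lam_eq_iff[OF a] closed by (metis k_closed rho_closed)
    qed
    with first show ?thesis
      unfolding ku a_def u_def[symmetric] v_def[symmetric] w_def[symmetric] by blast
  qed
  have "shelf_reflection X ?t \<kappa> \<longleftrightarrow> \<kappa> \<in> X \<rightarrow> X \<and>
    (\<forall>x \<in> X. \<forall>y \<in> X. \<kappa> (?t (\<kappa> (lam r x y)) x) = \<kappa> (?t (lam r x y) x) \<and>
      ?t (\<kappa> (?t (lam r x y) x)) (\<kappa> (lam r x y)) = \<kappa> (?t (\<kappa> (?t (lam r x y) x)) (lam r x y)))"
    unfolding shelf_reflection_def by (intro conj_cong refl ball_cong ball_lam)
  then show ?thesis
    unfolding reflection_iff_lam_rho by (simp only: pointwise cong: ball_cong)
qed

end

theorem corollary2p2: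
  fixes X :: "'a set" and r :: "'a \<times> 'a \<Rightarrow> 'a \<times> 'a" and \<kappa> :: "'a \<Rightarrow> 'a"
  assumes "yb_solution X r"
    and "left_nondegenerate X r"
    and "lam_centralizing X r \<kappa>"
  shows "reflection X r \<kappa> \<longleftrightarrow> reflection X (left_derived X r) \<kappa>"
proof -
  have "r \<in> X \<times> X \<rightarrow> X \<times> X"
    using assms(1) unfolding yb_solution_def by blast
  then show ?thesis
    using reflection_iff_shelf assms(2,3)
    unfolding left_derived_def reflection_shelf_solution_iff by blast
qed

end
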